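(* There exist a (Gromov) hyperbolic group $\Gamma$ and a finitely generated subgroup $H \le \Gamma$ such that $H$ has infinitely many conjugacy classes of finite-order elements.
   Context: Conjugacy classes of finite-order elements of $H$ are counted with respect to conjugation by elements of $H$ itself (not of the ambient group $\Gamma$). *)

theory Defs
  imports Complex_Main "HOL-Algebra.Algebra"
begin

definition finitely_generated :: "('a, 'b) monoid_scheme \<Rightarrow> bool" where
  "finitely_generated G \<longleftrightarrow>
     (\<exists>S. finite S \<and> S \<subseteq> carrier G \<and> generate G S = carrier G)"

text \<open>The minimum below is over a nonempty set of words whenever \<open>S\<close> generates \<open>G\<close>
  and \<open>g \<in> carrier G\<close>; no other case is used.\<close>

definition word_norm :: "('a, 'b) monoid_scheme \<Rightarrow> 'a set \<Rightarrow> 'a \<Rightarrow> nat" where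
  "word_norm G S g =
     (LEAST n. \<exists>ws. length ws = n \<and> set ws \<subseteq> S \<union> (\<lambda>s. inv\<^bsub>G\<^esub> s) ` S \<and>
                    foldr (\<lambda>x y. x \<otimes>\<^bsub>G\<^esub> y) ws \<one>\<^bsub>G\<^esub> = g)"

text \<open>The graph metric of the Cayley graph of \<open>G\<close> with respect to \<open>S\<close>, restricted to vertices.\<close>

definition word_dist :: "('a, 'b) monoid_scheme \<Rightarrow> 'a set \<Rightarrow> 'a \<Rightarrow> 'a \<Rightarrow> real" where
  "word_dist G S g h = real (word_norm G S (inv\<^bsub>G\<^esub> g \<otimes>\<^bsub>G\<^esub> h))"

definition gromov_product :: "('a \<Rightarrow> 'a \<Rightarrow> real) \<Rightarrow> 'a \<Rightarrow> 'a \<Rightarrow> 'a \<Rightarrow> real" where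
  "gromov_product d w x y = (d x w + d y w - d x y) / 2"

definition gromov_hyperbolic :: "'a set \<Rightarrow> ('a \<Rightarrow> 'a \<Rightarrow> real) \<Rightarrow> bool" where
  "gromov_hyperbolic M d \<longleftrightarrow>
     (\<exists>\<delta>\<ge>0. \<forall>w\<in>M. \<forall>x\<in>M. \<forall>y\<in>M. \<forall>z\<in>M.
        gromov_product d w x z \<ge> min (gromov_product d w x y) (gromov_product d w y z) - \<delta>)"

text \<open>Hyperbolicity does not depend on the finite generating set, so asking for one such set
  is the usual convention. Passing from the vertices to the geometric realization
  of the Cayley graph only changes \<open>\<delta>\<close>.\<close>

definition hyperbolic_group :: "('a, 'b) monoid_scheme \<Rightarrow> bool" where
  "hyperbolic_group G \<longleftrightarrow> group G \<and>
     (\<exists>S. finite S \<and> S \<subseteq> carrier G \<and> generate G S = carrier G \<and>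
          gromov_hyperbolic (carrier G) (word_dist G S))"

definition finite_order :: "('a, 'b) monoid_scheme \<Rightarrow> 'a \<Rightarrow> bool" where
  "finite_order G x \<longleftrightarrow> (\<exists>n::nat. n > 0 \<and> x [^]\<^bsub>G\<^esub> n = \<one>\<^bsub>G\<^esub>)"

definition conjugacy_class :: "('a, 'b) monoid_scheme \<Rightarrow> 'a \<Rightarrow> 'a set" where
  "conjugacy_class G x = {g \<otimes>\<^bsub>G\<^esub> x \<otimes>\<^bsub>G\<^esub> inv\<^bsub>G\<^esub> g | g. g \<in> carrier G}"

definition finite_order_classes :: "('a, 'b) monoid_scheme \<Rightarrow> 'a set set" where
  "finite_order_classes G = {conjugacy_class G x | x. x \<in> carrier G \<and> finite_order G x}"

end

theory Submission
  imports Defs "HOL-Library.Numeral_Type" "HOL-Library.Countable"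
begin

text \<open>The group is the right-angled Coxeter group \<open>W\<close> of the point-line incidence graph of the
  lines \<open>y + c = x m\<close> over the field with five elements. Word distance in a right-angled Coxeter
  group counts separating reflections. If two families of reflections of size at least two
  separated four points crosswise, the letters of two reduced words would span a complete
  bipartite subgraph containing a 4-cycle; the incidence graph has none, so \<open>W\<close> is hyperbolic.

  Points with \<open>x = 0, 1\<close> and \<open>x = 2, 3\<close> are sent to the two reflections generating the infinite
  dihedral group, those with \<open>x = 4\<close> to the identity, and likewise for the lines and \<open>m\<close>. This
  gives an action of \<open>W\<close> on a plane grid, and \<open>H\<close> consists of the elements moving the origin
  along the antidiagonal. Ascending and descending links of the height function (the coordinate
  sum) are connected, so by Bestvina-Brady Morse theory a slab around height \<open>0\<close> is connected;
  \<open>H\<close> acts on it with finitely many orbits and hence is finitely generated. The product \<open>t\<close> of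
  an incident point and line with \<open>x = m = 4\<close> lies in \<open>H\<close> and has a centralizer of order 4, because
  the graph has no triangles. Its conjugates by elements of different nonnegative heights lie in
  \<open>H\<close> but are not conjugate in \<open>H\<close>.\<close>

section \<open>Right-angled Coxeter groups\<close>

class simple_graph =
  fixes adj :: "'a \<Rightarrow> 'a \<Rightarrow> bool"
  assumes adj_sym: "adj s t \<Longrightarrow> adj t s"
    and adj_irrefl [simp]: "\<not> adj s s"

inductive racg_eq :: "'a::simple_graph list \<Rightarrow> 'a list \<Rightarrow> bool" where
  refl: "racg_eq u u"
| sym: "racg_eq u v \<Longrightarrow> racg_eq v u"
| trans: "racg_eq u v \<Longrightarrow> racg_eq v w \<Longrightarrow> racg_eq u w"
| cancel: "racg_eq (u @ s # s # v) (u @ v)"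
| swap: "adj s t \<Longrightarrow> racg_eq (u @ s # t # v) (u @ t # s # v)"

lemma racg_eq_appendL: "racg_eq u v \<Longrightarrow> racg_eq (w @ u) (w @ v)"
proof (induction rule: racg_eq.induct)
  case (cancel u s v)
  show ?case using racg_eq.cancel[of "w @ u"] by simp
next
  case (swap s t u v)
  then show ?case using racg_eq.swap[of s t "w @ u"] by simp
qed (metis racg_eq.refl racg_eq.sym racg_eq.trans)+

lemma racg_eq_appendR: "racg_eq u v \<Longrightarrow> racg_eq (u @ w) (v @ w)"
proof (induction rule: racg_eq.induct)
  case (cancel u s v)
  show ?case using racg_eq.cancel[of u s "v @ w"] by simp
next
  case (swap s t u v)
  then show ?case using racg_eq.swap[of s t u "v @ w"] by simp
qed (metis racg_eq.refl racg_eq.sym racg_eq.trans)+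

lemma racg_eq_rev: "racg_eq u v \<Longrightarrow> racg_eq (rev u) (rev v)"
proof (induction rule: racg_eq.induct)
  case (cancel u s v)
  show ?case using racg_eq.cancel[of "rev v" s "rev u"] by simp
next
  case (swap s t u v)
  then show ?case using racg_eq.swap[of t s "rev v" "rev u"] by (simp add: adj_sym)
qed (metis racg_eq.refl racg_eq.sym racg_eq.trans)+

lemma racg_eq_rev_append: "racg_eq (rev u @ u) []"
proof (induction u)
  case Nil
  then show ?case by (simp add: racg_eq.refl)
next
  case (Cons s u)
  have "racg_eq (rev u @ s # s # u) (rev u @ u)"
    by (rule racg_eq.cancel)
  then show ?case using Cons racg_eq.trans by auto
qed

quotient_type (overloaded) 'a racg = "'a::simple_graph list" / racg_eq
  by (intro equivpI reflpI sympI transpI) (metis racg_eq.refl racg_eq.sym racg_eq.trans)+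

text \<open>The group law is written additively: \<open>group_add\<close> is the only type class for
  noncommutative groups.\<close>

instantiation racg :: (simple_graph) group_add
begin

lift_definition zero_racg :: "'a racg" is "[]" .

lift_definition plus_racg :: "'a racg \<Rightarrow> 'a racg \<Rightarrow> 'a racg" is append
  by (meson racg_eq.trans racg_eq_appendL racg_eq_appendR)

lift_definition uminus_racg :: "'a racg \<Rightarrow> 'a racg" is rev
  by (rule racg_eq_rev)

definition minus_racg :: "'a racg \<Rightarrow> 'a racg \<Rightarrow> 'a racg" where
  "g - h = g + - h" for g h :: "'a racg"

instance
proof
  fix a b c :: "'a racg"
  show "a + b + c = a + (b + c)" by transfer (simp add: racg_eq.refl)
  show "0 + a = a" by transfer (simp add: racg_eq.refl)
  show "a + 0 = a" by transfer (simp add: racg_eq.refl)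
  show "- a + a = 0" by transfer (rule racg_eq_rev_append)
  show "a + - b = a - b" by (simp add: minus_racg_def)
qed

end

instance racg :: ("{simple_graph, countable}") countable
proof (rule countable_classI)
  fix g h :: "'a racg"
  show "to_nat (rep_racg g) = to_nat (rep_racg h) \<Longrightarrow> g = h"
    by (metis Quotient3_abs_rep Quotient3_racg inj_eq inj_to_nat)
qed

lift_definition word :: "'a::simple_graph list \<Rightarrow> 'a racg" is "\<lambda>w. w" .

abbreviation gen :: "'a::simple_graph \<Rightarrow> 'a racg" where
  "gen s \<equiv> word [s]"

lemma word_Nil [simp]: "word [] = 0"
  by transfer (rule racg_eq.refl)

lemma word_append: "word (u @ v) = word u + word v"
  by transfer (rule racg_eq.refl)

lemma word_Cons: "word (s # u) = gen s + word u"
  using word_append[of "[s]" u] by simp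

lemma word_rev: "word (rev u) = - word u"
  by transfer (rule racg_eq.refl)

lemma word_exhaust: obtains w where "g = word w"
  by transfer (blast intro: racg_eq.refl)

lemma word_eq_iff: "word u = word v \<longleftrightarrow> racg_eq u v"
  by transfer simp

lemma gen_twice [simp]: "gen s + gen s = 0"
proof -
  have "word ([s] @ [s]) = word []"
    unfolding word_eq_iff using racg_eq.cancel[of "[]" s "[]"] by simp
  then show ?thesis by (simp only: word_append word_Nil)
qed

lemma gen_gen_plus [simp]: "gen s + (gen s + g) = g"
  by (simp flip: add.assoc)

lemma uminus_gen [simp]: "- gen s = gen s"
  by (simp add: minus_unique)

lemma gen_commute: "adj s t \<Longrightarrow> gen s + gen t = gen t + gen s"
proof -
  assume "adj s t"
  then have "word ([s] @ [t]) = word ([t] @ [s])"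
    unfolding word_eq_iff using racg_eq.swap[of s t "[]" "[]"] by simp
  then show ?thesis by (simp only: word_append)
qed

lemma gen_conj_cancel [simp]: "gen s + (gen s + g + gen s) + gen s = g"
  by (simp add: add.assoc)

lemma gen_conj_eq_iff: "gen s + g + gen s = h \<longleftrightarrow> g = gen s + h + gen s"
  by (metis gen_conj_cancel)

lemma gen_conj_adj:
  assumes "adj s t"
  shows "gen s + gen t + gen s = gen t"
  unfolding gen_commute[OF assms] by (simp add: add.assoc)

lemma racg_induct [case_names zero gen_plus]:
  assumes "P 0" and "\<And>s g. P g \<Longrightarrow> P (gen s + g)"
  shows "P g"
proof -
  obtain w where "g = word w" by (rule word_exhaust)
  moreover have "P (word w)"
  proof (induction w)
    case (Cons s w)
    show ?case by (subst word_Cons) (rule assms(2)[OF Cons.IH])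
  qed (simp add: assms)
  ultimately show ?thesis by simp
qed

lemma racg_induct_right [case_names zero plus_gen]:
  assumes "P 0" and "\<And>s g. P g \<Longrightarrow> P (g + gen s)"
  shows "P g"
proof -
  have "P (- g)" for g
    by (induction g rule: racg_induct) (use assms in \<open>auto simp: minus_add\<close>)
  from this[of "- g"] show ?thesis by simp
qed

subsection \<open>Actions\<close>

text \<open>The word chosen by \<open>rep_racg\<close> is arbitrary; under the locale
  \<open>racg_action\<close> below the result does not depend on it.\<close>

definition act :: "('a::simple_graph \<Rightarrow> 'b \<Rightarrow> 'b) \<Rightarrow> 'a racg \<Rightarrow> 'b \<Rightarrow> 'b" where
  "act f g = foldr f (rep_racg g)"

locale racg_action =
  fixes f :: "'a::simple_graph \<Rightarrow> 'b \<Rightarrow> 'b"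
  assumes twice: "f s (f s b) = b"
    and commute: "adj s t \<Longrightarrow> f s (f t b) = f t (f s b)"
begin

lemma foldr_eq: "racg_eq u v \<Longrightarrow> foldr f u = foldr f v"
proof (induction rule: racg_eq.induct)
  case (swap s t u v)
  show ?case by (simp add: fun_eq_iff commute[OF swap])
qed (auto simp: fun_eq_iff twice)

lemma act_word: "act f (word w) = foldr f w"
proof -
  have "racg_eq (rep_racg (word w)) w"
    by (metis Quotient3_abs_rep Quotient3_racg word.abs_eq word_eq_iff)
  then show ?thesis unfolding act_def by (rule foldr_eq)
qed

lemma act_zero [simp]: "act f 0 b = b"
  using act_word[of "[]"] by simp

lemma act_gen [simp]: "act f (gen s) b = f s b"
  by (simp add: act_word)

lemma act_plus: "act f (g + h) b = act f g (act f h b)"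
proof -
  obtain u v where "g = word u" "h = word v" by (metis word_exhaust)
  then show ?thesis by (simp add: act_word flip: word_append)
qed

end

subsection \<open>Inversion sets\<close>

text \<open>This encodes the cocycle rule that N(s g) is the symmetric difference of {s} and s N(g)
  s. Since it respects the defining relations, the set built from the empty one along a word depends
  only on the group element.\<close>

definition flip :: "'a::simple_graph \<Rightarrow> 'a racg set \<Rightarrow> 'a racg set" where
  "flip s R = {r. (r = gen s) \<noteq> (gen s + r + gen s \<in> R)}"

lemma conj_image_iff: "r \<in> (\<lambda>q. gen s + q + gen s) ` R \<longleftrightarrow> gen s + r + gen s \<in> R"
proof
  assume "gen s + r + gen s \<in> R"
  then have "gen s + (gen s + r + gen s) + gen s \<in> (\<lambda>q. gen s + q + gen s) ` R"
    by (rule imageI)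
  then show "r \<in> (\<lambda>q. gen s + q + gen s) ` R" by simp
qed auto

lemma conj_eq_self_iff [simp]: "gen s + r + gen s = gen s \<longleftrightarrow> r = gen s"
  by (subst gen_conj_eq_iff) simp

lemma conj_eq_adj_iff: "adj s t \<Longrightarrow> gen s + r + gen s = gen t \<longleftrightarrow> r = gen t"
  by (subst gen_conj_eq_iff) (simp add: gen_conj_adj)

lemma conj_conj_adj:
  assumes "adj s t"
  shows "gen s + (gen t + r + gen t) + gen s = gen t + (gen s + r + gen s) + gen t"
proof -
  have "gen s + (gen t + r + gen t) + gen s = (gen s + gen t) + r + (gen t + gen s)"
    by (simp only: add.assoc)
  also have "\<dots> = (gen t + gen s) + r + (gen s + gen t)"
    by (simp only: gen_commute[OF assms])
  finally show ?thesis by (simp only: add.assoc)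
qed

interpretation flip: racg_action flip
proof
  fix s :: 'a and R
  show "flip s (flip s R) = R"
    by (auto simp: flip_def)
next
  fix s t :: 'a and R
  assume st: "adj s t"
  show "flip s (flip t R) = flip t (flip s R)"
    using conj_eq_adj_iff[OF st] conj_eq_adj_iff[OF adj_sym[OF st]]
    unfolding flip_def by (simp add: conj_conj_adj[OF st]) blast
qed

text \<open>The reflections whose walls separate \<open>0\<close> from \<open>g\<close> in the Cayley graph.\<close>

definition inversions :: "'a::simple_graph racg \<Rightarrow> 'a racg set" where
  "inversions g = act flip g {}"

lemma inversions_zero [simp]: "inversions 0 = {}"
  by (simp add: inversions_def)

lemma inversions_gen_plus:
  "r \<in> inversions (gen s + g) \<longleftrightarrow> (r = gen s) \<noteq> (gen s + r + gen s \<in> inversions g)"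
  by (simp add: inversions_def flip.act_plus) (simp add: flip_def)

lemma inversions_gen: "inversions (gen s) = {gen s}"
  using inversions_gen_plus[of _ s 0] by auto

lemma inversions_plus:
  "r \<in> inversions (g + h) \<longleftrightarrow> (r \<in> inversions g) \<noteq> (- g + r + g \<in> inversions h)"
proof (induction g arbitrary: r rule: racg_induct)
  case (gen_plus s g)
  have "- g + (gen s + r + gen s) + g = - (gen s + g) + r + (gen s + g)"
    by (simp add: minus_add add.assoc)
  then show ?case
    by (simp add: gen_plus inversions_gen_plus add.assoc) blast
qed simp

text \<open>Translation by \<open>g\<close> carries the walls between \<open>0\<close> and
  \<open>- g + h\<close> to those between \<open>g\<close> and \<open>h\<close>, and these are the
  walls separating \<open>0\<close> from exactly one of the two. Word distance thus becomes the size
  of a symmetric difference.\<close>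

lemma inversions_diff:
  "r \<in> inversions (- g + h) \<longleftrightarrow> (g + r - g \<in> inversions g) \<noteq> (g + r - g \<in> inversions h)"
  using inversions_plus[of r "- g" g] inversions_plus[of r "- g" h] by simp

lemma finite_inversions [simp]: "finite (inversions g)"
proof (induction g rule: racg_induct)
  case (gen_plus s g)
  have "inversions (gen s + g) \<subseteq> insert (gen s) ((\<lambda>r. gen s + r + gen s) ` inversions g)"
    by (auto simp: inversions_gen_plus conj_image_iff)
  then show ?case using gen_plus finite_subset by blast
qed simp

lemma card_inversions_diff:
  "card (inversions (- g + h)) = card (sym_diff (inversions g) (inversions h))"
proof -
  have "(\<lambda>r. g + r - g) ` inversions (- g + h) = sym_diff (inversions g) (inversions h)"
  proof (intro equalityI subsetI)
    fix r assume "r \<in> sym_diff (inversions g) (inversions h)"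
    then have "- g + r + g \<in> inversions (- g + h)"
      by (auto simp: inversions_diff add.assoc)
    then show "r \<in> (\<lambda>r. g + r - g) ` inversions (- g + h)"
      by (force simp: add.assoc)
  qed (auto simp: inversions_diff)
  moreover have "inj (\<lambda>r. g + r - g)"
    by (rule inj_on_inverseI[of _ "\<lambda>r. - g + r + g"])
      (simp add: add.assoc diff_conv_add_uminus del: add_uminus_conv_diff)
  ultimately show ?thesis
    by (metis card_image inj_on_subset subset_UNIV)
qed

section \<open>Reduced words, exchange and deletion\<close>

text \<open>These are the walls crossed in turn by the path that spells the word: each letter is
  conjugated by the prefix before it.\<close>

fun reflections :: "'a::simple_graph list \<Rightarrow> 'a racg list" where
  "reflections [] = []"
| "reflections (s # w) = gen s # map (\<lambda>r. gen s + r + gen s) (reflections w)"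

lemma length_reflections [simp]: "length (reflections w) = length w"
  by (induction w) auto

text \<open>That crossing no wall twice amounts to minimal length follows from
  \<open>card_inversions_le\<close> and \<open>card_inversions_reduced\<close>.\<close>

abbreviation reduced :: "'a::simple_graph list \<Rightarrow> bool" where
  "reduced w \<equiv> distinct (reflections w)"

lemma inversions_word_reduced: "reduced w \<Longrightarrow> inversions (word w) = set (reflections w)"
proof (induction w)
  case (Cons s w)
  then have IH: "inversions (word w) = set (reflections w)"
    by (simp add: distinct_map)
  have "gen s \<notin> (\<lambda>r. gen s + r + gen s) ` set (reflections w)"
    using Cons.prems by simp
  then have "r \<in> inversions (word (s # w)) \<longleftrightarrow> r \<in> set (reflections (s # w))" for r
    by (subst word_Cons) (auto simp: inversions_gen_plus IH conj_image_iff)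
  then show ?case by blast
qed simp

text \<open>Left multiplication by the wall of a letter deletes that letter: with the prefix p
  before the letter s and the rest q, (p s p^-1) (p s q) = p q.\<close>

lemma exchange:
  "r \<in> set (reflections w) \<Longrightarrow>
    \<exists>u. length u < length w \<and> set u \<subseteq> set w \<and> word u = r + word w"
proof (induction w arbitrary: r)
  case (Cons s w)
  show ?case
  proof (cases "r = gen s")
    case True
    then have "word w = r + word (s # w)"
      by (subst word_Cons) simp
    then show ?thesis by force
  next
    case False
    then obtain q where q: "q \<in> set (reflections w)" "r = gen s + q + gen s"
      using Cons.prems by auto
    then obtain u where u: "length u < length w" "set u \<subseteq> set w" "word u = q + word w"
      using Cons.IH by blast
    have "word (s # u) = r + word (s # w)"
      unfolding word_Cons[of s u] word_Cons[of s w] by (simp add: u q add.assoc)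
    then show ?thesis using u by (intro exI[of _ "s # u"]) auto
  qed
qed simp

lemma deletion:
  "\<not> reduced w \<Longrightarrow> \<exists>u. length u < length w \<and> set u \<subseteq> set w \<and> word u = word w"
proof (induction w)
  case (Cons s w)
  show ?case
  proof (cases "reduced w")
    case False
    then obtain u where u: "length u < length w" "set u \<subseteq> set w" "word u = word w"
      using Cons.IH by blast
    have "word (s # u) = word (s # w)"
      unfolding word_Cons[of s u] word_Cons[of s w] by (simp add: u)
    then show ?thesis using u by (intro exI[of _ "s # u"]) auto
  next
    case True
    \<comment> \<open>Conjugation keeps the walls of the reduced tail distinct, so the repeated wall
      is the first one, and conjugation by \<open>s\<close> fixes it.\<close>
    then have "gen s \<in> set (reflections w)"
      using Cons.prems by (auto simp: distinct_map inj_on_def conj_image_iff)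
    then obtain u where u: "length u < length w" "set u \<subseteq> set w" "word u = gen s + word w"
      using exchange by blast
    then show ?thesis
      using word_Cons[of s w] by (intro exI[of _ u]) auto
  qed
qed simp

lemma ex_reduced: "\<exists>u. reduced u \<and> set u \<subseteq> set w \<and> word u = word w"
proof (induction w rule: length_induct)
  case (1 w)
  then show ?case
    by (cases "reduced w") (use deletion[of w] in \<open>auto, metis subset_trans\<close>)
qed

lemma reduced_word_exhaust:
  obtains w where "g = word w" "reduced w"
  by (metis ex_reduced word_exhaust)

lemma card_inversions_le: "card (inversions (word w)) \<le> length w"
proof (induction w rule: length_induct)
  case (1 w)
  show ?case
  proof (cases "reduced w")
    case True
    then show ?thesis by (simp add: inversions_word_reduced distinct_card)
  next
    case False
    then show ?thesis using deletion 1 by (metis le_trans less_imp_le)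
  qed
qed

lemma card_inversions_reduced: "reduced w \<Longrightarrow> card (inversions (word w)) = length w"
  by (simp add: inversions_word_reduced distinct_card)

lemma card_inversions_less:
  assumes "r \<in> inversions g"
  shows "card (inversions (r + g)) < card (inversions g)"
proof -
  obtain w where w: "g = word w" "reduced w" by (rule reduced_word_exhaust)
  then obtain u where "length u < length w" "word u = r + word w"
    using exchange[of r w] assms by (auto simp: inversions_word_reduced)
  then show ?thesis
    using w card_inversions_le[of u] by (simp add: card_inversions_reduced)
qed

section \<open>Descents and meets in the weak order\<close>

text \<open>In the infinite dihedral group acting on the integers by \<open>n \<mapsto> - n\<close> and \<open>n \<mapsto> 1 - n\<close>,
  the walls crossed by a reduced word all lie on one side of the base point.\<close>

lemma dihedral_reflections:
  fixes s t :: "'a::simple_graph"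
  assumes "s \<noteq> t" "\<not> adj s t"
  defines "f \<equiv> \<lambda>u n. if u = s then - n else if u = t then 1 - n else (n :: int)"
  shows "set w \<subseteq> {s, t} \<Longrightarrow> reduced w \<Longrightarrow> r \<in> set (reflections w) \<Longrightarrow>
    \<exists>c. (\<forall>n. act f r n = c - n) \<and> (if hd w = s then c \<le> 0 else c \<ge> 1)"
proof (induction w arbitrary: r)
  case (Cons x w)
  interpret f: racg_action f
    by standard (use assms adj_sym in \<open>auto simp: f_def\<close>)
  have x: "x = s \<or> x = t" using Cons.prems by simp
  then have fx: "f x n = (if x = s then - n else 1 - n)" for n
    using assms(1) by (auto simp: f_def)
  show ?case
  proof (cases "r = gen x")
    case True
    then show ?thesis
      using x assms(1) by (intro exI[of _ "if x = s then 0 else 1"]) (simp add: fx)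
  next
    case False
    then obtain q where q: "q \<in> set (reflections w)" "r = gen x + q + gen x"
      using Cons.prems by auto
    then have "w \<noteq> []" by auto
    then obtain y v where w: "w = y # v" by (cases w) auto
    have y: "y = s \<or> y = t" "y \<noteq> x"
      using Cons.prems by (auto simp: w add.assoc)
    obtain c where c: "\<And>n. act f q n = c - n" "if hd w = s then c \<le> 0 else c \<ge> 1"
      using Cons.IH[OF _ _ q(1)] Cons.prems by (auto simp: distinct_map)
    show ?thesis
      using x y c assms(1)
      by (intro exI[of _ "if x = s then - c else 2 - c"])
        (auto simp: q f.act_plus w fx split: if_splits)
  qed
qed simp

text \<open>Letters that do not commute generate an infinite dihedral group, in which no element has
  both of them as descents. Splitting \<open>g\<close> into an element of that subgroup and a
  shortest coset representative reduces the claim to this case.\<close>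

lemma descents_adj:
  fixes s t :: "'a::simple_graph"
  assumes "gen s \<in> inversions g" "gen t \<in> inversions g" "s \<noteq> t"
  shows "adj s t"
proof (rule ccontr)
  assume st: "\<not> adj s t"
  define D where "D = word ` lists {s, t}"
  have D_plus: "d + e \<in> D" if "d \<in> D" "e \<in> D" for d e
  proof -
    obtain u v where "d = word u" "e = word v" "u \<in> lists {s, t}" "v \<in> lists {s, t}"
      using \<open>d \<in> D\<close> \<open>e \<in> D\<close> unfolding D_def by blast
    then have "d + e = word (u @ v)" "u @ v \<in> lists {s, t}"
      by (simp_all add: word_append)
    then show ?thesis unfolding D_def by blast
  qed
  have D_minus: "- d \<in> D" if "d \<in> D" for d
  proof -
    obtain u where "d = word u" "u \<in> lists {s, t}"
      using \<open>d \<in> D\<close> unfolding D_def by blast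
    then have "- d = word (rev u)" "rev u \<in> lists {s, t}"
      by (simp_all add: word_rev in_lists_conv_set)
    then show ?thesis unfolding D_def by blast
  qed
  have D_gen: "gen s \<in> D" "gen t \<in> D" by (auto simp: D_def)
  have "0 \<in> D" using imageI[of "[]" "lists {s, t}" word] by (simp add: D_def)
  \<comment> \<open>\<open>d + g\<close> is a shortest element of the coset of \<open>g\<close>, and
    \<open>- d\<close> is the dihedral part of \<open>g\<close>.\<close>
  then obtain d where d: "d \<in> D"
      and min: "\<And>e. e \<in> D \<Longrightarrow> card (inversions (d + g)) \<le> card (inversions (e + g))"
    using ex_has_least_nat[of "\<lambda>d. d \<in> D" 0 "\<lambda>d. card (inversions (d + g))"] by blast
  \<comment> \<open>Otherwise \<open>r + d\<close> would yield a shorter element of the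
    coset.\<close>
  have no_D: "r \<notin> inversions (d + g)" if "r \<in> D" for r
    using card_inversions_less[of r "d + g"] min[of "r + d"] D_plus[OF that d]
    by (auto simp: add.assoc)
  have D_inv: "r \<in> inversions (- d)" if "r \<in> D" "r \<in> inversions g" for r
  proof -
    have "d + r + - d \<in> D" using that d by (simp add: D_plus D_minus del: add_uminus_conv_diff)
    then show ?thesis
      using that no_D inversions_plus[of r "- d" "d + g"] by (simp add: add.assoc)
  qed
  obtain w where "- d = word w" "set w \<subseteq> {s, t}"
    using D_minus[OF d] by (auto simp: D_def)
  then obtain u where u: "- d = word u" "set u \<subseteq> {s, t}" "reduced u"
    using ex_reduced[of w] by (metis subset_trans)
  have mem: "gen s \<in> set (reflections u)" "gen t \<in> set (reflections u)"
    using D_inv D_gen assms u by (auto simp: inversions_word_reduced)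
  define f where "f = (\<lambda>u n. if u = s then - n else if u = t then 1 - n else (n :: int))"
  interpret f: racg_action f
    by standard (use assms(3) st adj_sym in \<open>auto simp: f_def\<close>)
  note dih = dihedral_reflections[OF assms(3) st u(2,3), folded f_def]
  obtain b where b: "\<forall>n. act f (gen s) n = b - n" "if hd u = s then b \<le> 0 else b \<ge> 1"
    using dih[OF mem(1)] by blast
  obtain c where c: "\<forall>n. act f (gen t) n = c - n" "if hd u = s then c \<le> 0 else c \<ge> 1"
    using dih[OF mem(2)] by blast
  \<comment> \<open>The walls of \<open>s\<close> and \<open>t\<close> have parameters 0 and 1,
    hence lie on different sides of the base point, against \<open>dih\<close>.\<close>
  have "f s 0 = 0" "f t 0 = 1" using assms(3) by (simp_all add: f_def)
  then have "b = 0" "c = 1" using b(1) c(1) by (metis f.act_gen diff_zero)+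
  then show False using b(2) c(2) by (auto split: if_splits)
qed

lemma ex_descent:
  assumes "inversions g \<noteq> {}"
  shows "\<exists>s. gen s \<in> inversions g"
proof -
  obtain w where w: "g = word w" "reduced w" by (rule reduced_word_exhaust)
  then obtain s v where "w = s # v"
    using assms by (cases w) auto
  then show ?thesis using w by (auto simp: inversions_word_reduced)
qed

text \<open>Strip a descent \<open>s\<close> of \<open>x\<close> from both elements. If
  \<open>s\<close> is no descent of \<open>y\<close>, it becomes one of \<open>gen s + y\<close>, so
  it commutes with the common descent \<open>u\<close> found by induction; conjugation by
  \<open>s\<close> then fixes \<open>gen u\<close>, which therefore survives putting
  \<open>s\<close> back.\<close>

lemma ex_common_descent:
  "r \<in> inversions x \<Longrightarrow> r \<in> inversions y \<Longrightarrow> \<exists>u. gen u \<in> inversions x \<inter> inversions y"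
proof (induction "card (inversions x)" arbitrary: x y r rule: less_induct)
  case less
  obtain s where s: "gen s \<in> inversions x" using less.prems ex_descent by blast
  show ?case
  proof (cases "gen s \<in> inversions y")
    case False
    then have "r \<noteq> gen s" using less.prems by blast
    then have "gen s + r + gen s \<in> inversions (gen s + x)"
      "gen s + r + gen s \<in> inversions (gen s + y)"
      using less.prems by (auto simp: inversions_gen_plus)
    then obtain u where u: "gen u \<in> inversions (gen s + x)" "gen u \<in> inversions (gen s + y)"
      using less.hyps[OF card_inversions_less[OF s]] by blast
    have "u \<noteq> s" using s u(1) by (auto simp: inversions_gen_plus)
    have "gen s \<in> inversions (gen s + y)"
      using False by (auto simp: inversions_gen_plus add.assoc)
    then have "adj s u" using u(2) \<open>u \<noteq> s\<close> descents_adj by metis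
    moreover have "gen u \<noteq> gen s"
      using u(1) s by (auto simp: inversions_gen_plus)
    ultimately show ?thesis
      using u by (auto simp: inversions_gen_plus gen_conj_adj)
  qed (use s in blast)
qed

text \<open>These are meets in the weak order. Common descents are stripped from both elements until
  no wall is shared.\<close>

lemma ex_meet: "\<exists>p. inversions p = inversions x \<inter> inversions y"
proof (induction "card (inversions x)" arbitrary: x y rule: less_induct)
  case less
  show ?case
  proof (cases "inversions x \<inter> inversions y = {}")
    case True
    then show ?thesis by (intro exI[of _ 0]) simp
  next
    case False
    then obtain u where u: "gen u \<in> inversions x" "gen u \<in> inversions y"
      using ex_common_descent by blast
    obtain p where p: "inversions p = inversions (gen u + x) \<inter> inversions (gen u + y)"
      using less.hyps[OF card_inversions_less[OF u(1)]] by blast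
    have "inversions (gen u + p) = inversions x \<inter> inversions y"
      using u by (auto simp: inversions_gen_plus p)
    then show ?thesis by blast
  qed
qed

section \<open>Commuting initial segments and crossing families of walls\<close>

text \<open>The first letter of \<open>w\<close> and \<open>s\<close> are both descents of
  \<open>y\<close>, so they commute; after stripping that letter, \<open>s\<close> is still a
  descent and the argument repeats.\<close>

lemma letter_adj_word:
  "reduced w \<Longrightarrow> set (reflections w) \<subseteq> inversions y \<Longrightarrow> gen s \<in> inversions y \<Longrightarrow>
    gen s \<notin> set (reflections w) \<Longrightarrow> t \<in> set w \<Longrightarrow> adj s t"
proof (induction w arbitrary: y)
  case (Cons x w)
  have sx: "adj s x"
    using Cons.prems descents_adj[of s y x] by auto
  then have conj: "gen x + gen s + gen x = gen s"
    by (simp add: gen_conj_adj adj_sym)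
  show ?case
  proof (cases "t = x")
    case False
    have "set (reflections w) \<subseteq> inversions (gen x + y)"
      using Cons.prems by (auto simp: inversions_gen_plus conj_image_iff)
    moreover have "gen s \<in> inversions (gen x + y)"
      using Cons.prems conj by (auto simp: inversions_gen_plus)
    moreover have "gen s \<notin> set (reflections w)"
      using Cons.prems conj by (force simp: image_iff)
    ultimately show ?thesis
      using Cons.IH[of "gen x + y"] Cons.prems False by (auto simp: distinct_map)
  qed (use sx in simp)
qed simp

lemma conj_reflections_adj:
  "(\<And>t. t \<in> set w \<Longrightarrow> adj s t) \<Longrightarrow> r \<in> set (reflections w) \<Longrightarrow> gen s + r + gen s = r"
proof (induction w arbitrary: r)
  case (Cons x w)
  have sx: "adj s x" using Cons.prems by simp
  show ?case
  proof (cases "r = gen x")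
    case False
    then obtain q where q: "q \<in> set (reflections w)" "r = gen x + q + gen x"
      using Cons.prems by auto
    have "gen s + (gen x + q + gen x) + gen s = gen x + (gen s + q + gen s) + gen x"
      by (rule conj_conj_adj[OF sx])
    then show ?thesis using q Cons by auto
  qed (simp add: gen_conj_adj[OF sx])
qed simp

text \<open>By \<open>letter_adj_word\<close> the first letter of \<open>v\<close> commutes with all
  of \<open>w\<close>. Stripping it therefore leaves the walls of \<open>w\<close> in place, and the
  induction continues with the rest of \<open>v\<close>.\<close>

lemma words_adj:
  "reduced v \<Longrightarrow> reduced w \<Longrightarrow> set (reflections v) \<inter> set (reflections w) = {} \<Longrightarrow>
    set (reflections v) \<subseteq> inversions y \<Longrightarrow> set (reflections w) \<subseteq> inversions y \<Longrightarrow>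
    s \<in> set v \<Longrightarrow> t \<in> set w \<Longrightarrow> adj s t"
proof (induction v arbitrary: y)
  case (Cons x v)
  have x: "adj x t" if "t \<in> set w" for t
    using letter_adj_word[of w y x t] Cons.prems that by auto
  then have conj: "gen x + r + gen x = r" if "r \<in> set (reflections w)" for r
    using conj_reflections_adj that by blast
  show ?case
  proof (cases "s = x")
    case False
    have "r \<notin> set (reflections w)" if "r \<in> set (reflections v)" for r
    proof
      assume r: "r \<in> set (reflections w)"
      then have "r \<in> set (reflections (x # v))"
        using that conj[OF r] by (simp add: conj_image_iff)
      then show False using Cons.prems(3) r by blast
    qed
    then have "set (reflections v) \<inter> set (reflections w) = {}" by blast
    moreover have "set (reflections v) \<subseteq> inversions (gen x + y)"
      using Cons.prems by (auto simp: inversions_gen_plus conj_image_iff)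
    moreover have "set (reflections w) \<subseteq> inversions (gen x + y)"
      using Cons.prems conj by (auto simp: inversions_gen_plus)
    ultimately show ?thesis
      using Cons.IH[of "gen x + y"] Cons.prems False by (auto simp: distinct_map)
  qed (use x Cons.prems in simp)
qed simp

lemma reduced_single_letter:
  assumes "reduced w" "\<And>s t. s \<in> set w \<Longrightarrow> t \<in> set w \<Longrightarrow> s = t"
  shows "length w \<le> 1"
proof (rule ccontr)
  assume "\<not> length w \<le> 1"
  then obtain s u where su: "w = s # u" "u \<noteq> []"
    by (cases w) auto
  then obtain t v where "u = t # v"
    by (cases u) auto
  then have "w = s # s # v" using assms(2)[of s t] su by simp
  then show False using assms(1) by simp
qed

text \<open>The two families are the walls crossed from \<open>p\<close> to the meets
  \<open>x'\<close> and \<open>z'\<close>, both of which lie below \<open>y\<close>. By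
  \<open>words_adj\<close> the letters of the two reduced words commute with each other. A reduced
  word of length at least two has two different letters, so two such words would give a
  4-cycle.\<close>

lemma crossing_card_le_1:
  fixes x y z :: "'a::simple_graph racg"
  assumes square_free:
    "\<And>a b c d :: 'a. adj a c \<Longrightarrow> adj a d \<Longrightarrow> adj b c \<Longrightarrow> adj b d \<Longrightarrow> a = b \<or> c = d"
  shows "card (inversions x \<inter> inversions y - inversions z) \<le> 1 \<or>
    card (inversions y \<inter> inversions z - inversions x) \<le> 1"
proof -
  obtain x' where x': "inversions x' = inversions x \<inter> inversions y" using ex_meet by blast
  obtain z' where z': "inversions z' = inversions y \<inter> inversions z" using ex_meet by blast
  obtain p where p: "inversions p = inversions x' \<inter> inversions z'" using ex_meet by blast
  obtain v where v: "- p + x' = word v" "reduced v" by (metis reduced_word_exhaust)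
  obtain w where w: "- p + z' = word w" "reduced w" by (metis reduced_word_exhaust)
  have refl_v: "set (reflections v) = inversions (- p + x')"
    and refl_w: "set (reflections w) = inversions (- p + z')"
    using v w by (simp_all add: inversions_word_reduced)
  have adj: "adj s t" if "s \<in> set v" "t \<in> set w" for s t
  proof (rule words_adj[of v w "- p + y"])
    show "set (reflections v) \<inter> set (reflections w) = {}"
      "set (reflections v) \<subseteq> inversions (- p + y)"
      "set (reflections w) \<subseteq> inversions (- p + y)"
      by (auto simp: refl_v refl_w inversions_diff p x' z')
  qed (use that v w in auto)
  have "length v = card (sym_diff (inversions p) (inversions x'))"
    "length w = card (sym_diff (inversions p) (inversions z'))"
    using card_inversions_reduced[OF v(2)] card_inversions_diff[of p x'] v(1)
      card_inversions_reduced[OF w(2)] card_inversions_diff[of p z'] w(1)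
    by simp_all
  moreover have "sym_diff (inversions p) (inversions x') = inversions x \<inter> inversions y - inversions z"
    "sym_diff (inversions p) (inversions z') = inversions y \<inter> inversions z - inversions x"
    by (auto simp: p x' z')
  moreover have "length v \<le> 1 \<or> length w \<le> 1"
  proof (rule ccontr)
    assume "\<not> (length v \<le> 1 \<or> length w \<le> 1)"
    then obtain a b c d where "a \<in> set v" "b \<in> set v" "a \<noteq> b" "c \<in> set w" "d \<in> set w" "c \<noteq> d"
      using reduced_single_letter[OF v(2)] reduced_single_letter[OF w(2)] by blast
    then show False using adj square_free by blast
  qed
  ultimately show ?thesis by simp
qed

section \<open>Centralizers of products of two commuting generators\<close>

lemma gen_eq_iff [simp]: "gen s = gen t \<longleftrightarrow> s = t" for s t :: "'a::simple_graph"
proof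
  \<comment> \<open>The action on two points in which only \<open>s\<close> moves anything tells
    \<open>s\<close> from the other generators.\<close>
  define f where "f = (\<lambda>u b. if u = s then \<not> b else b)"
  interpret f: racg_action f
    by standard (auto simp: f_def)
  assume "gen s = gen t"
  then have "f s True = f t True" by (metis f.act_gen)
  then show "s = t" by (simp add: f_def split: if_splits)
qed simp

lemma gen_self_inversion: "gen s \<in> inversions (gen s + g) \<longleftrightarrow> gen s \<notin> inversions g"
  by (simp add: inversions_gen_plus)

lemma inversions_empty: "inversions g = {} \<Longrightarrow> g = 0"
  by (rule reduced_word_exhaust[of g]) (use card_inversions_reduced in fastforce)

text \<open>A descent \<open>a\<close> or \<open>b\<close> of \<open>p\<close> commutes with
  \<open>t\<close> and can be stripped. If \<open>p\<close> has neither, then \<open>t + p\<close>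
  is longer than \<open>p\<close> by at least two and has both as descents. All inversions of
  \<open>p\<close> then persist in \<open>p + t = t + p\<close>, so a descent of \<open>p\<close>
  would commute with \<open>a\<close> and \<open>b\<close> and close a triangle.\<close>

lemma centralizer_rotation:
  fixes p :: "'a::simple_graph racg"
  assumes triangle_free: "\<And>a b c :: 'a. adj a b \<Longrightarrow> adj a c \<Longrightarrow> \<not> adj b c"
    and ab: "adj a b"
  defines "t \<equiv> gen a + gen b"
  shows "p + t = t + p \<Longrightarrow> p \<in> {0, gen a, gen b, t}"
proof (induction "card (inversions p)" arbitrary: p rule: less_induct)
  case less
  have t_ba: "t = gen b + gen a" unfolding t_def by (rule gen_commute[OF ab])
  have at: "gen a + t = t + gen a"
  proof -
    have "gen a + (gen b + gen a) = gen a + gen b + gen a" by (simp only: add.assoc)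
    then show ?thesis by (simp only: flip: t_ba) (simp only: flip: t_def)
  qed
  have bt: "gen b + t = t + gen b"
  proof -
    have "gen b + (gen a + gen b) = gen b + gen a + gen b" by (simp only: add.assoc)
    then show ?thesis by (simp only: flip: t_ba) (simp only: flip: t_def)
  qed
  have comm: "gen s + p + t = t + (gen s + p)" if "gen s + t = t + gen s" for s
  proof -
    have "gen s + p + t = gen s + (t + p)" by (simp only: add.assoc less.prems)
    also have "\<dots> = t + gen s + p" by (simp only: flip: add.assoc that)
    finally show ?thesis by (simp only: add.assoc)
  qed
  have "a \<noteq> b" using ab by auto
  consider "gen a \<in> inversions p" | "gen b \<in> inversions p"
    | "gen a \<notin> inversions p" "gen b \<notin> inversions p" by blast
  then show ?case
  proof cases
    case 1
    define q where "q = gen a + p"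
    have "q \<in> {0, gen a, gen b, t}"
      unfolding q_def by (rule less.hyps[OF card_inversions_less[OF 1] comm[OF at]])
    moreover have "p = gen a + q" by (simp add: q_def)
    ultimately show ?thesis by (auto simp: t_def)
  next
    case 2
    define q where "q = gen b + p"
    have "q \<in> {0, gen a, gen b, t}"
      unfolding q_def by (rule less.hyps[OF card_inversions_less[OF 2] comm[OF bt]])
    moreover have "p = gen b + q" by (simp add: q_def)
    ultimately show ?thesis by (auto simp: t_ba)
  next
    case 3
    have a: "gen a \<notin> inversions (gen b + p)"
      using 3 \<open>a \<noteq> b\<close> gen_conj_adj[OF adj_sym[OF ab]] by (simp add: inversions_gen_plus)
    have b: "gen b \<notin> inversions (gen a + p)"
      using 3 \<open>a \<noteq> b\<close> gen_conj_adj[OF ab] by (simp add: inversions_gen_plus)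
    have "t + p = gen a + (gen b + p)" by (simp only: t_def add.assoc)
    moreover have "t + p = gen b + (gen a + p)" by (simp only: t_ba add.assoc)
    ultimately have tp: "gen a \<in> inversions (t + p)" "gen b \<in> inversions (t + p)"
      using a b by (metis gen_self_inversion)+
    have "gen b \<in> inversions (gen b + p)" using 3 by (simp add: inversions_gen_plus)
    then have "card (inversions p) < card (inversions (gen b + p))"
      using card_inversions_less[of "gen b" "gen b + p"] by simp
    moreover have "card (inversions (gen b + p)) < card (inversions (t + p))"
      using card_inversions_less[OF tp(1)] by (simp add: t_def add.assoc)
    ultimately have "card (inversions p) + 2 \<le> card (inversions (p + t))"
      using less.prems by simp
    \<comment> \<open>The inversions of \<open>t\<close> conjugated by \<open>p\<close>, that is,
      the walls between \<open>p\<close> and \<open>p + t\<close>. There are at most two of them, so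
      a gain of two in length means that none is already an inversion of \<open>p\<close>.\<close>
    define P where "P = {p + gen a - p, p + gen b - p}"
    have t: "inversions t = {gen a, gen b}"
      by (auto simp: t_def inversions_gen_plus inversions_gen conj_eq_adj_iff[OF ab])
        (use ab in auto)
    have conj: "- p + r + p = q \<longleftrightarrow> r = p + q - p" for q r
      by (auto simp: add.assoc diff_conv_add_uminus simp del: add_uminus_conv_diff)
    have sub: "r \<in> inversions (p + t) \<longleftrightarrow> (r \<in> inversions p) \<noteq> (r \<in> P)" for r
      by (simp add: inversions_plus[of r p t] t conj P_def)
    have "card P \<le> 2" by (simp add: P_def card_insert_if)
    have "finite P" by (simp add: P_def)
    have "card (inversions (p + t)) \<le> card ((inversions p - P) \<union> P)"
      using sub \<open>finite P\<close> by (intro card_mono) auto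
    also have "\<dots> \<le> card (inversions p - P) + 2"
      using card_Un_le[of "inversions p - P" P] \<open>card P \<le> 2\<close> by linarith
    finally have "card (inversions p) \<le> card (inversions p - P)"
      using \<open>card (inversions p) + 2 \<le> card (inversions (p + t))\<close> by linarith
    then have "inversions p - P = inversions p"
      by (intro card_seteq) auto
    then have "inversions p \<inter> P = {}" by blast
    then have "inversions p \<subseteq> inversions (t + p)" using sub less.prems by auto
    have "inversions p = {}"
    proof (rule ccontr)
      assume "inversions p \<noteq> {}"
      then obtain c where c: "gen c \<in> inversions p" using ex_descent by blast
      then have "c \<noteq> a" "c \<noteq> b" using 3 by auto
      moreover have "gen c \<in> inversions (t + p)"
        using c \<open>inversions p \<subseteq> inversions (t + p)\<close> by blast
      ultimately have "adj c a" "adj c b" using descents_adj tp by blast+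
      then show False using triangle_free ab by blast
    qed
    then show ?thesis using inversions_empty by blast
  qed
qed

subsection \<open>Square-free right-angled Coxeter groups are hyperbolic\<close>

text \<open>The group is copied into \<open>nat\<close> along \<open>to_nat\<close> to obtain a
  \<open>nat monoid\<close>; the \<open>itself\<close> argument only names the type.\<close>

definition nat_group :: "'g::{group_add, countable} itself \<Rightarrow> nat monoid" where
  "nat_group _ = \<lparr>carrier = range (to_nat :: 'g \<Rightarrow> nat),
    monoid.mult = (\<lambda>m n. to_nat (from_nat m + from_nat n :: 'g)), one = to_nat (0 :: 'g)\<rparr>"

lemma carrier_nat_group [simp]:
    "carrier (nat_group TYPE('g)) = range (to_nat :: 'g::{group_add, countable} \<Rightarrow> nat)"
  and mult_nat_group [simp]:
    "to_nat (g :: 'g) \<otimes>\<^bsub>nat_group TYPE('g)\<^esub> to_nat h = to_nat (g + h)"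
  and one_nat_group [simp]: "\<one>\<^bsub>nat_group TYPE('g)\<^esub> = to_nat (0 :: 'g)"
  by (simp_all add: nat_group_def)

lemma group_nat_group: "group (nat_group TYPE('g::{group_add, countable}))"
proof (rule groupI)
  fix x assume "x \<in> carrier (nat_group TYPE('g))"
  then obtain g :: 'g where "x = to_nat g" by auto
  then have "to_nat (- g) \<otimes>\<^bsub>nat_group TYPE('g)\<^esub> x = \<one>\<^bsub>nat_group TYPE('g)\<^esub>" by simp
  then show "\<exists>y\<in>carrier (nat_group TYPE('g)). y \<otimes>\<^bsub>nat_group TYPE('g)\<^esub> x = \<one>\<^bsub>nat_group TYPE('g)\<^esub>"
    by auto
qed (auto simp: add.assoc)

lemma inv_nat_group [simp]:
  "inv\<^bsub>nat_group TYPE('g)\<^esub> (to_nat (g :: 'g::{group_add, countable})) = to_nat (- g)"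
  by (rule group.inv_equality[OF group_nat_group]) auto

text \<open>Generators are their own inverses, so formal inverses add no letters, and reduced words
  attain the minimum.\<close>

lemma word_norm_racg:
  fixes g :: "'a::{simple_graph, countable} racg"
  shows "word_norm (nat_group TYPE('a racg)) (to_nat ` range (gen :: 'a \<Rightarrow> 'a racg)) (to_nat g) =
    card (inversions g)"
    (is "word_norm ?G ?S _ = _")
proof -
  have S: "?S \<union> (\<lambda>s. inv\<^bsub>?G\<^esub> s) ` ?S = ?S"
    by (auto simp: image_image)
  have foldr: "foldr (\<lambda>x y. x \<otimes>\<^bsub>?G\<^esub> y) (map (\<lambda>s. to_nat (gen s)) w) \<one>\<^bsub>?G\<^esub> = to_nat (word w)"
    for w :: "'a list"
    by (induction w) (simp, subst word_Cons, simp)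
  have words: "(\<exists>ws. length ws = n \<and> set ws \<subseteq> ?S \<and> foldr (\<lambda>x y. x \<otimes>\<^bsub>?G\<^esub> y) ws \<one>\<^bsub>?G\<^esub> = to_nat g)
    \<longleftrightarrow> (\<exists>w. length w = n \<and> word w = g)" (is "?L \<longleftrightarrow> ?R") for n
  proof
    assume ?L
    then obtain ws where ws: "length ws = n" "set ws \<subseteq> ?S"
      "foldr (\<lambda>x y. x \<otimes>\<^bsub>?G\<^esub> y) ws \<one>\<^bsub>?G\<^esub> = to_nat g" by blast
    have "ws \<in> lists (range (\<lambda>s :: 'a. to_nat (gen s)))"
      using ws(2) by (auto simp: image_image)
    then obtain w :: "'a list" where "ws = map (\<lambda>s. to_nat (gen s)) w"
      unfolding lists_image by auto
    then show ?R using ws foldr[of w] by (intro exI[of _ w]) simp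
  next
    assume ?R
    then obtain w where w: "length w = n" "word w = g" by blast
    then show ?L using foldr[of w]
      by (intro exI[of _ "map (\<lambda>s. to_nat (gen s)) w"]) auto
  qed
  show ?thesis
    unfolding word_norm_def S words
  proof (rule Least_equality)
    obtain w where "g = word w" "reduced w" by (rule reduced_word_exhaust)
    then show "\<exists>w. length w = card (inversions g) \<and> word w = g"
      by (metis card_inversions_reduced)
  qed (use card_inversions_le in auto)
qed

lemma generate_racg:
  "generate (nat_group TYPE('a racg)) (to_nat ` range (gen :: 'a \<Rightarrow> 'a racg)) =
    carrier (nat_group TYPE('a::{simple_graph, countable} racg))"
    (is "generate ?G ?S = _")
proof
  show "generate ?G ?S \<subseteq> carrier ?G"
    by (rule group.generate_incl[OF group_nat_group]) auto
  have "to_nat g \<in> generate ?G ?S" for g :: "'a racg"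
  proof (induction g rule: racg_induct)
    case zero
    show ?case using generate.one[of ?G ?S] by simp
  next
    case (gen_plus s g)
    have "to_nat (gen s) \<in> generate ?G ?S" by (rule generate.incl) simp
    then show ?case using generate.eng[OF _ gen_plus] by fastforce
  qed
  then show "carrier ?G \<subseteq> generate ?G ?S" by auto
qed

text \<open>The Gromov product at \<open>w\<close> counts the walls separating \<open>w\<close> from
  both points. Of the two intersections compared in the four-point condition, one exceeds the third
  by at most one wall, by \<open>crossing_card_le_1\<close>; hence delta is 1.\<close>

lemma hyperbolic_racg:
  assumes square_free:
    "\<And>a b c d :: 'a. adj a c \<Longrightarrow> adj a d \<Longrightarrow> adj b c \<Longrightarrow> adj b d \<Longrightarrow> a = b \<or> c = d"
  shows "hyperbolic_group (nat_group TYPE('a::{simple_graph, finite} racg))"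
    (is "hyperbolic_group ?G")
proof -
  define d where "d = word_dist ?G (to_nat ` range (gen :: 'a \<Rightarrow> 'a racg))"
  have d: "d (to_nat g) (to_nat h) = card (inversions (- g + h))" for g h :: "'a racg"
    by (simp add: d_def word_dist_def word_norm_racg)
  have gp: "gromov_product d (to_nat w) (to_nat x) (to_nat y) =
    card (inversions (- w + x) \<inter> inversions (- w + y))" for w x y :: "'a racg"
  proof -
    define A where "A = inversions (- w + x)"
    define B where "B = inversions (- w + y)"
    have fin: "finite A" "finite B" by (simp_all add: A_def B_def)
    have "- x + y = - (- w + x) + (- w + y)" by (simp add: minus_add add.assoc)
    then have "card (inversions (- x + y)) = card (sym_diff A B)"
      by (simp only: card_inversions_diff A_def B_def)
    moreover have "card (sym_diff A B) = card (A - B) + card (B - A)"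
      using fin by (intro card_Un_disjoint) auto
    moreover have "card A = card (A - B) + card (A \<inter> B)"
      using fin by (simp add: card_Diff_subset_Int card_mono)
    moreover have "card B = card (B - A) + card (A \<inter> B)"
      using fin by (simp add: card_Diff_subset_Int card_mono Int_commute)
    moreover have "card (inversions (- x + w)) = card A"
      using card_inversions_diff[of x w] card_inversions_diff[of w x]
      by (simp add: A_def Un_commute)
    moreover have "card (inversions (- y + w)) = card B"
      using card_inversions_diff[of y w] card_inversions_diff[of w y]
      by (simp add: B_def Un_commute)
    ultimately show ?thesis
      by (simp add: gromov_product_def d flip: A_def B_def)
  qed
  have "min (gromov_product d (to_nat w) (to_nat x) (to_nat y))
      (gromov_product d (to_nat w) (to_nat y) (to_nat z)) - 1
    \<le> gromov_product d (to_nat w) (to_nat x) (to_nat z)" for w x y z :: "'a racg"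
  proof -
    define A where "A = inversions (- w + x)"
    define B where "B = inversions (- w + y)"
    define C where "C = inversions (- w + z)"
    have fin: "finite A" "finite B" "finite C" by (simp_all add: A_def B_def C_def)
    have "card (A \<inter> B) \<le> card (A \<inter> B - C) + card (A \<inter> C)"
      using card_mono[of "(A \<inter> B - C) \<union> (A \<inter> C)" "A \<inter> B"] card_Un_le[of "A \<inter> B - C" "A \<inter> C"] fin
      by (simp add: subset_iff)
    moreover have "card (B \<inter> C) \<le> card (B \<inter> C - A) + card (A \<inter> C)"
      using card_mono[of "(B \<inter> C - A) \<union> (A \<inter> C)" "B \<inter> C"] card_Un_le[of "B \<inter> C - A" "A \<inter> C"] fin
      by (simp add: subset_iff)
    moreover have "card (A \<inter> B - C) \<le> 1 \<or> card (B \<inter> C - A) \<le> 1"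
      unfolding A_def B_def C_def using crossing_card_le_1 square_free by blast
    ultimately show ?thesis
      by (auto simp: gp simp flip: A_def B_def C_def)
  qed
  then have "gromov_hyperbolic (carrier ?G) d"
    unfolding gromov_hyperbolic_def by (intro exI[of _ 1]) auto
  then show ?thesis
    unfolding hyperbolic_group_def d_def
    using group_nat_group generate_racg
    by (intro conjI exI[of _ "to_nat ` range (gen :: 'a \<Rightarrow> 'a racg)"]) auto
qed

section \<open>The incidence graph of the affine plane over the field with five elements\<close>

lemma UNIV_5: "(UNIV :: 5 set) = {0, 1, 2, 3, 4}"
proof -
  have "card {0, 1, 2, 3, 4 :: 5} = CARD(5)" by simp
  then show ?thesis by (metis card_subset_eq finite subset_UNIV)
qed

lemma no_zero_divisors_5: "a * b = 0 \<Longrightarrow> a = 0 \<or> b = 0" for a b :: 5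
proof -
  have "\<forall>a\<in>UNIV. \<forall>b\<in>UNIV. a * b = 0 \<longrightarrow> a = 0 \<or> b = (0 :: 5)"
    unfolding UNIV_5 by simp
  then show "a * b = 0 \<Longrightarrow> a = 0 \<or> b = 0" by simp
qed

datatype vertex = Pt 5 5 | Ln 5 5

instance vertex :: finite
proof
  have "v \<in> range (\<lambda>(x, y). Pt x y) \<union> range (\<lambda>(m, c). Ln m c)" for v
    by (cases v) auto
  then have "UNIV = range (\<lambda>(x, y). Pt x y) \<union> range (\<lambda>(m, c). Ln m c)"
    by blast
  then show "finite (UNIV :: vertex set)"
    by (metis finite finite_UnI finite_imageI)
qed

instantiation vertex :: simple_graph
begin

text \<open>The vertical lines of the plane are left out, and this form of the equation makes points
  and lines interchangeable.\<close>

fun adj_vertex :: "vertex \<Rightarrow> vertex \<Rightarrow> bool" where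
  "adj_vertex (Pt x y) (Ln m c) \<longleftrightarrow> y + c = x * m"
| "adj_vertex (Ln m c) (Pt x y) \<longleftrightarrow> y + c = x * m"
| "adj_vertex _ _ \<longleftrightarrow> False"

instance
proof
  show "adj s t \<Longrightarrow> adj t s" for s t :: vertex
    by (cases s; cases t) auto
  show "\<not> adj s s" for s :: vertex
    by (cases s) auto
qed

end

text \<open>Adding the equations in opposite pairs gives \<open>(x - x') * (m - m') = 0\<close>: two
  different lines share at most one point.\<close>

lemma plane_square_free:
  fixes x y m c :: 5
  assumes "y + c = x * m" "y + c' = x * m'" "y' + c = x' * m" "y' + c' = x' * m'"
  shows "x = x' \<and> y = y' \<or> m = m' \<and> c = c'"
proof -
  have "x * m + x' * m' = x * m' + x' * m"
    unfolding assms[symmetric] by (simp add: algebra_simps)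
  then have "(x - x') * (m - m') = 0"
    by (simp add: algebra_simps)
  then have "x - x' = 0 \<or> m - m' = 0" by (rule no_zero_divisors_5)
  then show ?thesis
  proof
    assume "x - x' = 0"
    then have "y + c = y' + c" using assms(1,3) by simp
    then show ?thesis using \<open>x - x' = 0\<close> by simp
  next
    assume "m - m' = 0"
    then have "y + c = y + c'" using assms(1,2) by simp
    then show ?thesis using \<open>m - m' = 0\<close> by simp
  qed
qed

lemma vertex_square_free:
  fixes a b c d :: vertex
  assumes "adj a c" "adj a d" "adj b c" "adj b d"
  shows "a = b \<or> c = d"
  using assms plane_square_free
  by (cases a; cases b; cases c; cases d) (simp_all, blast+)

lemma vertex_triangle_free: "adj a b \<Longrightarrow> adj a c \<Longrightarrow> \<not> adj b c" for a b c :: vertex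
  by (cases a; cases b; cases c) auto

text \<open>Each sign belongs to two consecutive residues; \<open>half_plane_connected\<close> uses
  the two to move between points and between slopes.\<close>

definition dir :: "5 \<Rightarrow> int" where
  "dir x = (if x \<in> {0, 1} then 1 else if x \<in> {2, 3} then -1 else 0)"

lemma dir_simps [simp]: "dir 0 = 1" "dir 1 = 1" "dir 2 = -1" "dir 3 = -1" "dir 4 = 0"
  by (simp_all add: dir_def)

lemma dir_cases: "dir x = 0 \<or> dir x = 1 \<or> dir x = -1"
  by (simp add: dir_def)

text \<open>Going from a point through a line to another point, and back through a line of a
  different slope, shifts the second coordinate by \<open>1\<close>.\<close>

lemma half_plane_connected:
  assumes E: "equivp E"
    and e: "e \<in> {1, -1}" "e' \<in> {1, -1}"
    and adj: "\<And>x y m c. dir x = e \<Longrightarrow> dir m = e' \<Longrightarrow> y + c = x * m \<Longrightarrow> E (Pt x y) (Ln m c)"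
    and s: "case s of Pt x y \<Rightarrow> dir x = e | Ln m c \<Rightarrow> dir m = e'"
    and t: "case t of Pt x y \<Rightarrow> dir x = e | Ln m c \<Rightarrow> dir m = e'"
  shows "E s t"
proof -
  have sym: "E b a" if "E a b" for a b
    using E that by (rule equivp_symp)
  have trans: "E a c" if "E a b" "E b c" for a b c
    using E that by (rule equivp_transp)
  \<comment> \<open>The residues of direction \<open>e\<close> are \<open>x\<close> and
    \<open>x + 1\<close>, those of direction \<open>e'\<close> are \<open>m\<close> and
    \<open>m + 1\<close>.\<close>
  define x where "x = (if e = 1 then 0 else 2 :: 5)"
  define m where "m = (if e' = 1 then 0 else 2 :: 5)"
  have dir: "dir x = e" "dir (x + 1) = e" "dir m = e'" "dir (m + 1) = e'"
    using e by (auto simp: x_def m_def)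
  have line: "E (Pt x y) (Pt x' (y + (x' - x) * m))"
    if "dir x = e" "dir x' = e" "dir m = e'" for x x' y m
    by (rule trans[OF adj[of x m y "x * m - y"] sym[OF adj[of x' m _ "x * m - y"]]])
      (use that in \<open>auto simp: algebra_simps\<close>)
  have shift: "E (Pt x y) (Pt x (y + 1))" for y
    using trans[OF line[OF dir(1,2,4), of y] line[OF dir(2,1,3)]] by (simp add: algebra_simps)
  have vertical: "E (Pt x 0) (Pt x y)" for y
  proof -
    have 0: "E (Pt x 0) (Pt x 0)" using E by (rule equivp_reflp)
    have 1: "E (Pt x 0) (Pt x 1)" using shift[of 0] by simp
    have 2: "E (Pt x 0) (Pt x 2)" using trans[OF 1 shift] by simp
    have 3: "E (Pt x 0) (Pt x 3)" using trans[OF 2 shift] by simp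
    have 4: "E (Pt x 0) (Pt x 4)" using trans[OF 3 shift] by simp
    have "\<forall>y\<in>UNIV. E (Pt x 0) (Pt x y)" unfolding UNIV_5 using 0 1 2 3 4 by blast
    then show ?thesis by blast
  qed
  have "E (Pt x 0) s"
    if "case s of Pt x y \<Rightarrow> dir x = e | Ln m c \<Rightarrow> dir m = e'" for s
  proof (cases s)
    case (Pt x' y)
    show ?thesis
      using trans[OF vertical line[OF dir(1) _ dir(3)], of x' "y - (x' - x) * m"] that Pt by simp
  next
    case (Ln m' c)
    show ?thesis
      using trans[OF vertical adj[OF dir(1)], of m' "x * m' - c" c] that Ln by simp
  qed
  then show ?thesis using s t sym trans by blast
qed

subsection \<open>The action on the plane and the height function\<close>

text \<open>Direction 0 stands for the identity and not for the reflection of the integers in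
  0.\<close>

definition refl_at :: "int \<Rightarrow> int \<Rightarrow> int" where
  "refl_at e n = (if e = 0 then n else e - n)"

fun move :: "vertex \<Rightarrow> int \<times> int \<Rightarrow> int \<times> int" where
  "move (Pt x y) (a, b) = (refl_at (dir x) a, b)"
| "move (Ln m c) (a, b) = (a, refl_at (dir m) b)"

interpretation move: racg_action move
proof
  show "move s (move s b) = b" for s b
    by (cases s; cases b) (auto simp: refl_at_def)
  show "adj s t \<Longrightarrow> move s (move t b) = move t (move s b)" for s t b
    by (cases s; cases t; cases b) auto
qed

definition posA :: "vertex racg \<Rightarrow> int" where "posA g = fst (act move g (0, 0))"
definition posB :: "vertex racg \<Rightarrow> int" where "posB g = snd (act move g (0, 0))"

definition sg :: "int \<Rightarrow> int" where "sg a = (if even a then 1 else -1)"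

text \<open>On each axis, the reflections in 1/2 and -1/2 reverse the orientation and change the
  parity of the image of 0. That parity therefore determines the orientation.\<close>

lemma act_move: "act move g (i, j) = (posA g + sg (posA g) * i, posB g + sg (posB g) * j)"
proof (induction g arbitrary: i j rule: racg_induct)
  case zero
  show ?case by (simp add: posA_def posB_def sg_def)
next
  case (gen_plus s g)
  have pos: "(posA (gen s + g), posB (gen s + g)) = move s (posA g, posB g)"
    by (simp add: posA_def posB_def move.act_plus)
  show ?case
  proof (cases s)
    case (Pt x y)
    then show ?thesis
      using pos dir_cases[of x] by (auto simp: move.act_plus gen_plus refl_at_def sg_def)
  next
    case (Ln m c)
    then show ?thesis
      using pos dir_cases[of m] by (auto simp: move.act_plus gen_plus refl_at_def sg_def)
  qed
qed

lemma posA_plus: "posA (g + h) = posA g + sg (posA g) * posA h"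
  and posB_plus: "posB (g + h) = posB g + sg (posB g) * posB h"
  using act_move[of g "posA h" "posB h"]
  by (simp_all add: posA_def posB_def move.act_plus)

lemma pos_zero [simp]: "posA 0 = 0" "posB 0 = 0"
  by (simp_all add: posA_def posB_def)

lemma pos_gen [simp]:
  "posA (gen (Pt x y)) = dir x" "posB (gen (Pt x y)) = 0"
  "posA (gen (Ln m c)) = 0" "posB (gen (Ln m c)) = dir m"
  by (simp_all add: posA_def posB_def refl_at_def)

definition height :: "vertex racg \<Rightarrow> int" where "height g = posA g + posB g"

lemma height_zero [simp]: "height 0 = 0"
  by (simp add: height_def)

lemma height_plus_Pt: "height (g + gen (Pt x y)) = height g + sg (posA g) * dir x"
  and height_plus_Ln: "height (g + gen (Ln m c)) = height g + sg (posB g) * dir m"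
  by (simp_all add: height_def posA_plus posB_plus)

lemma sg_cases: "sg a = 1 \<or> sg a = -1"
  by (simp add: sg_def)

lemma height_plus_gen_cases:
  "height (g + gen s) = height g \<or> height (g + gen s) = height g + 1 \<or>
    height (g + gen s) = height g - 1"
proof (cases s)
  case (Pt x y)
  then show ?thesis
    using sg_cases[of "posA g"] dir_cases[of x] by (auto simp: height_plus_Pt)
next
  case (Ln m c)
  then show ?thesis
    using sg_cases[of "posB g"] dir_cases[of m] by (auto simp: height_plus_Ln)
qed

text \<open>At height 0 both coordinates have the same parity, so \<open>g\<close> preserves or
  reverses both axes at once and only changes the sign of heights. This makes \<open>level\<close>
  below a subgroup.\<close>

lemma height_plus_level:
  assumes "height g = 0"
  shows "height (g + h) = sg (posA g) * height h"
proof -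
  have "posB g = - posA g" using assms by (simp add: height_def)
  then show ?thesis
    by (simp add: height_def posA_plus posB_plus sg_def)
qed

lemma height_uminus:
  assumes "height g = 0"
  shows "height (- g) = 0"
  using height_plus_level[OF assms, of "- g"] by (auto simp: sg_def split: if_splits)

text \<open>Equal parities make \<open>g - h\<close> preserve the orientation of both axes, so
  heights subtract. Thus height and parity determine the coset of \<open>level\<close>, which leaves
  finitely many cosets in a slab.\<close>

lemma height_diff:
  assumes "height g = height h" "even (posA g) = even (posA h)"
  shows "height (g - h) = 0"
proof -
  have g: "posA g = posA (g - h) + sg (posA (g - h)) * posA h"
    "posB g = posB (g - h) + sg (posB (g - h)) * posB h"
    using posA_plus[of "g - h" h] posB_plus[of "g - h" h] by simp_all
  have "even (posA g + posB g) = even (posA h + posB h)"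
    using assms by (simp add: height_def)
  then have "even (posB g) = even (posB h)" using assms(2) by auto
  then have "even (posA (g - h))" "even (posB (g - h))"
    using g assms(2) by (auto simp: sg_def split: if_splits)
  then show ?thesis using g assms(1) by (simp add: height_def sg_def)
qed

subsection \<open>Connected slabs\<close>

text \<open>These are the Cayley graph edges in a band of heights. The sign \<open>e\<close> turns
  the picture upside down, so that one lemma serves to lower the top and to raise the
  bottom.\<close>

definition slab :: "int \<Rightarrow> int \<Rightarrow> int \<Rightarrow> (vertex racg \<times> vertex racg) set" where
  "slab e k n = {(g, g + gen s) | g s. e * height g \<in> {-k..n} \<and> e * height (g + gen s) \<in> {-k..n}}"

lemma slabI:
  "e * height g \<in> {-k..n} \<Longrightarrow> e * height (g + gen s) \<in> {-k..n} \<Longrightarrow> (g, g + gen s) \<in> slab e k n"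
  by (auto simp: slab_def)

lemma sym_slab: "sym (slab e k n)"
proof (rule symI)
  fix g h assume "(g, h) \<in> slab e k n"
  then obtain s where s: "h = g + gen s" "e * height g \<in> {-k..n}" "e * height h \<in> {-k..n}"
    by (auto simp: slab_def)
  then have "h + gen s = g" by (simp add: add.assoc)
  then show "(h, g) \<in> slab e k n" using slabI[of e h k n s] s by simp
qed

lemma slab_mono: "k \<le> k' \<Longrightarrow> n \<le> n' \<Longrightarrow> (slab e k n)\<^sup>* \<subseteq> (slab e k' n')\<^sup>*"
  by (rule rtrancl_mono) (force simp: slab_def)

lemma slab_turn: "slab (-1) k n = slab 1 n k"
proof -
  have "(- 1) * i \<in> {- k..n} \<longleftrightarrow> 1 * i \<in> {- n..k}" for i :: int by auto
  then show ?thesis by (simp only: slab_def)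
qed

text \<open>A vertex of maximal height is replaced by a lower neighbour. Since the descending link is
  connected and every horizontal edge has a commuting descending edge, replacing all of them
  turns paths into paths.\<close>

lemma slab_push:
  assumes e: "e \<in> {1, -1}" and k: "0 \<le> k" and n: "2 \<le> n"
    and gh: "(g, h) \<in> (slab e k n)\<^sup>*" and g: "e * height g < n" and h: "e * height h < n"
  shows "(g, h) \<in> (slab e k (n - 1))\<^sup>*"
proof -
  define E where "E = (slab e k (n - 1))\<^sup>*"
  have E_sym: "(v, u) \<in> E" if "(u, v) \<in> E" for u v
    using that unfolding E_def by (rule symD[OF sym_rtrancl[OF sym_slab]])
  have E_trans: "(u, w) \<in> E" if "(u, v) \<in> E" "(v, w) \<in> E" for u v w
    using that unfolding E_def by (rule rtrancl_trans)
  have E_refl: "(u, u) \<in> E" for u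
    unfolding E_def by (rule rtrancl_refl)
  have E_edge: "(u, u + gen s) \<in> E"
    if "e * height u \<in> {-k..n - 1}" "e * height (u + gen s) \<in> {-k..n - 1}" for u s
    using slabI[OF that] unfolding E_def by blast
  \<comment> \<open>Commuting descending steps span a square whose far corner, at
    \<open>n - 2\<close>, is still in the slab because \<open>2 \<le> n\<close> and
    \<open>0 \<le> k\<close>.\<close>
  have E_square: "(u + gen s, u + gen t) \<in> E"
    if "adj s t" "e * height (u + gen s) = n - 1" "e * height (u + gen t) = n - 1"
      "e * height (u + gen s + gen t) = n - 2" for u s t
  proof (rule E_trans[of _ "u + gen s + gen t"])
    show "(u + gen s, u + gen s + gen t) \<in> E"
      by (rule E_edge) (use that n k in simp_all)
    have eq: "u + gen s + gen t = u + gen t + gen s"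
      by (simp only: add.assoc gen_commute[OF that(1)])
    have "e * height (u + gen t + gen s) = n - 2"
      using that(4) unfolding eq .
    then show "(u + gen s + gen t, u + gen t) \<in> E"
      unfolding eq by (intro E_sym[OF E_edge]) (use that(3) n k in simp_all)
  qed
  have low: "(u + gen s, u + gen t) \<in> E"
    if u: "e * height u = n" and s: "e * height (u + gen s) < n" and t: "e * height (u + gen t) < n"
    for u s t
  proof -
    \<comment> \<open>\<open>a\<close> and \<open>b\<close> are the directions of the points and
      lines that lead down from \<open>u\<close>.\<close>
    define a where "a = - e * sg (posA u)"
    define b where "b = - e * sg (posB u)"
    have ab: "a \<in> {1, -1}" "b \<in> {1, -1}"
      using e sg_cases[of "posA u"] sg_cases[of "posB u"] by (auto simp: a_def b_def)
    have down: "case s of Pt x y \<Rightarrow> dir x = a | Ln m c \<Rightarrow> dir m = b"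
      if "e * height (u + gen s) < n" for s
    proof (cases s)
      case (Pt x y)
      then show ?thesis
        using that u e sg_cases[of "posA u"] dir_cases[of x]
        by (auto simp: a_def height_plus_Pt)
    next
      case (Ln m c)
      then show ?thesis
        using that u e sg_cases[of "posB u"] dir_cases[of m]
        by (auto simp: b_def height_plus_Ln)
    qed
    have sq: "e * (sg i * (e * sg i)) = 1" for i
      using e sg_cases[of i] by auto
    show ?thesis
    proof (rule half_plane_connected[of "\<lambda>s t. (u + gen s, u + gen t) \<in> E"])
      show "equivp (\<lambda>s t. (u + gen s, u + gen t) \<in> E)"
        by (intro equivpI reflpI sympI transpI) (fact E_refl, erule E_sym, erule E_trans)
      show "a \<in> {1, -1}" "b \<in> {1, -1}" by (fact ab)+
      fix x y m c assume *: "dir x = a" "dir m = b" "y + c = x * m"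
      show "(u + gen (Pt x y), u + gen (Ln m c)) \<in> E"
      proof (rule E_square)
        show "adj (Pt x y) (Ln m c)" using * by simp
        show "e * height (u + gen (Pt x y)) = n - 1" "e * height (u + gen (Ln m c)) = n - 1"
          "e * height (u + gen (Pt x y) + gen (Ln m c)) = n - 2"
          using u * sq[of "posA u"] sq[of "posB u"]
          by (simp_all add: height_plus_Pt height_plus_Ln posB_plus a_def b_def distrib_left right_diff_distrib)
      qed
    qed (use down s t in blast)+
  qed
  \<comment> \<open>Residues 2 and 0 have directions -1 and 1; the choice makes the added point lead
    down.\<close>
  define lower where "lower u = (if e * height u = n then
    u + gen (Pt (if e * sg (posA u) = 1 then 2 else 0) 0) else u)" for u
  have lower_height: "e * height (u + gen (Pt (if e * sg (posA u) = 1 then 2 else 0) 0)) < n"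
    if "e * height u = n" for u
    using that e sg_cases[of "posA u"] by (auto simp: height_plus_Pt)
  have lower_down: "(lower u, u + gen s) \<in> E"
    if "e * height u = n" "e * height (u + gen s) < n" for u s
    using low[OF that(1) lower_height[OF that(1)] that(2)] that(1) by (simp add: lower_def)
  have lower_edge: "(lower u, lower (u + gen s)) \<in> E"
    if u: "e * height u \<in> {-k..n}" and us: "e * height (u + gen s) \<in> {-k..n}" for u s
  proof -
    have undo: "u + gen s + gen s = u" by (simp add: add.assoc)
    consider "e * height u < n" "e * height (u + gen s) < n"
      | "e * height u = n" "e * height (u + gen s) < n"
      | "e * height u < n" "e * height (u + gen s) = n"
      | "e * height u = n" "e * height (u + gen s) = n"
      using u us by fastforce
    then show ?thesis
    proof cases
      case 1
      then show ?thesis using E_edge[of u s] u us by (simp add: lower_def)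
    next
      case 2
      then show ?thesis using lower_down[of u s] by (simp add: lower_def)
    next
      case 3
      then show ?thesis
        using E_sym[OF lower_down[of "u + gen s" s]] by (simp add: lower_def undo)
    next
      case 4
      \<comment> \<open>At the top a horizontal edge has a letter of direction 0. A point lies on a
        line of every slope, and a line has a point with every first coordinate, so some neighbour
        \<open>t\<close> leads down from both ends.\<close>
      obtain t where t: "adj s t" "e * height (u + gen t) < n" "e * height (u + gen s + gen t) < n"
        "e * height (u + gen t) \<ge> - k" "e * height (u + gen s + gen t) \<ge> - k"
      proof (cases s)
        case (Pt x y)
        define m where "m = (if e * sg (posB u) = 1 then 2 else 0 :: 5)"
        have "dir x = 0"
          using 4 e sg_cases[of "posA u"] Pt by (auto simp: height_plus_Pt)
        moreover have "e * (sg (posB u) * dir m) = - 1"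
          using e sg_cases[of "posB u"] by (auto simp: m_def)
        ultimately show ?thesis
          using that[of "Ln m (x * m - y)"] 4 Pt n k
          by (simp add: height_plus_Pt height_plus_Ln posB_plus distrib_left)
      next
        case (Ln m c)
        define x where "x = (if e * sg (posA u) = 1 then 2 else 0 :: 5)"
        have "dir m = 0"
          using 4 e sg_cases[of "posB u"] Ln by (auto simp: height_plus_Ln)
        moreover have "e * (sg (posA u) * dir x) = - 1"
          using e sg_cases[of "posA u"] by (auto simp: x_def)
        ultimately show ?thesis
          using that[of "Pt x (x * m - c)"] 4 Ln n k
          by (simp add: height_plus_Pt height_plus_Ln posA_plus distrib_left)
      qed
      have eq: "u + gen s + gen t = u + gen t + gen s"
        by (simp only: add.assoc gen_commute[OF t(1)])
      have "(u + gen t, u + gen s + gen t) \<in> E"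
        unfolding eq by (rule E_edge) (use t(2,4) t(3,5)[unfolded eq] in simp_all)
      then show ?thesis
        using E_trans[OF lower_down[OF 4(1) t(2)] E_trans[OF _ E_sym[OF lower_down[OF 4(2) t(3)]]]]
        by blast
    qed
  qed
  have "(lower g, lower h) \<in> E"
    using gh
  proof (induction rule: rtrancl_induct)
    case (step u v)
    then obtain s where s: "v = u + gen s" "e * height u \<in> {-k..n}" "e * height (u + gen s) \<in> {-k..n}"
      by (auto simp: slab_def)
    then show ?case using E_trans[OF step.IH lower_edge[OF s(2,3)]] by simp
  qed (simp add: E_def)
  then show ?thesis using g h by (simp add: lower_def E_def)
qed

lemma slab_push_to_1:
  assumes e: "e \<in> {1, -1}" and k: "0 \<le> k" and g: "e * height g \<le> 1" and h: "e * height h \<le> 1"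
  shows "(g, h) \<in> (slab e k (1 + int m))\<^sup>* \<Longrightarrow> (g, h) \<in> (slab e k 1)\<^sup>*"
proof (induction m)
  case (Suc m)
  then have "(g, h) \<in> (slab e k (1 + int (Suc m) - 1))\<^sup>*"
    using e k g h by (intro slab_push) auto
  then show ?case using Suc.IH by simp
qed simp

lemma ex_slab_path: "\<exists>m. (0, g) \<in> (slab 1 (1 + int m) (1 + int m))\<^sup>*"
proof (induction g rule: racg_induct_right)
  case (plus_gen s g)
  then obtain m where m: "(0, g) \<in> (slab 1 (1 + int m) (1 + int m))\<^sup>*" by blast
  define l where "l = m + nat \<bar>height g\<bar> + 1"
  have "(0, g) \<in> (slab 1 (1 + int l) (1 + int l))\<^sup>*"
    using slab_mono[of "1 + int m" "1 + int l" "1 + int m" "1 + int l"] m by (auto simp: l_def)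
  moreover have "(g, g + gen s) \<in> slab 1 (1 + int l) (1 + int l)"
    by (rule slabI) (use height_plus_gen_cases[of g s] in \<open>auto simp: l_def\<close>)
  ultimately show ?case by (meson rtrancl.rtrancl_into_rtrancl)
qed blast

text \<open>Some path to \<open>g\<close> lies in a wide slab. Its top is pushed down to 1, then the
  slab is turned over and the other side is treated in the same way. The pushing stops at 1 because
  \<open>slab_push\<close> asks for \<open>2 \<le> n\<close>.\<close>

lemma level_connected:
  assumes "height g = 0"
  shows "(0, g) \<in> (slab 1 1 1)\<^sup>*"
proof -
  obtain m where "(0, g) \<in> (slab 1 (1 + int m) (1 + int m))\<^sup>*"
    using ex_slab_path by blast
  then have "(0, g) \<in> (slab 1 (1 + int m) 1)\<^sup>*"
    using assms by (intro slab_push_to_1) auto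
  then have "(0, g) \<in> (slab (-1) 1 (1 + int m))\<^sup>*"
    by (simp add: slab_turn)
  then have "(0, g) \<in> (slab (-1) 1 1)\<^sup>*"
    using assms by (intro slab_push_to_1) auto
  then show ?thesis by (simp add: slab_turn)
qed

subsection \<open>The level subgroup\<close>

definition level :: "vertex racg set" where "level = {g. height g = 0}"

lemma level_zero: "0 \<in> level"
  by (simp add: level_def)

lemma level_plus: "g \<in> level \<Longrightarrow> h \<in> level \<Longrightarrow> g + h \<in> level"
  by (simp add: level_def height_plus_level)

lemma level_uminus: "g \<in> level \<Longrightarrow> - g \<in> level"
  by (simp add: level_def height_uminus)

abbreviation coxeter_group :: "nat monoid" where
  "coxeter_group \<equiv> nat_group TYPE(vertex racg)"

lemma subgroup_level: "subgroup (to_nat ` level) coxeter_group"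
  by (rule group.subgroupI[OF group_nat_group])
    (use level_zero level_uminus level_plus in auto)

text \<open>A Schreier argument along slab paths: each edge from \<open>u\<close> to
  \<open>v\<close> contributes one generator comparing the coset representatives of its ends, and
  only finitely many cosets meet the slab.\<close>

lemma finitely_generated_level:
  "finitely_generated (coxeter_group\<lparr>carrier := to_nat ` level\<rparr>)"
proof -
  define key where "key g = (height g, even (posA g))" for g
  define K where "K = {-1..1 :: int} \<times> (UNIV :: bool set)"
  define rep where "rep k = (SOME g. key g = k)" for k
  \<comment> \<open>The representatives lying in \<open>level\<close> are included because the one
    chosen for the coset of \<open>0\<close> may differ from \<open>0\<close>. Intersecting with
    \<open>level\<close> discards combinations that come from no edge and leave the
    subgroup.\<close>
  define T where "T = (rep ` K \<union> (\<lambda>(k, s, l). rep k + gen s - rep l) ` (K \<times> UNIV \<times> K)) \<inter> level"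
  define G where "G = generate coxeter_group (to_nat ` T)"
  have rep: "key (rep (key g)) = key g" for g
    unfolding rep_def by (rule someI) simp
  have key_eqD: "height g = height h" "even (posA g) \<longleftrightarrow> even (posA h)" if "key g = key h" for g h
    using that by (simp_all add: key_def)
  have diff_rep: "g - rep (key g) \<in> level" for g
    unfolding level_def using height_diff[OF key_eqD[OF rep[symmetric]]] by blast
  have G_plus: "to_nat (g + h) \<in> G" if "to_nat g \<in> G" "to_nat h \<in> G" for g h :: "vertex racg"
    using generate.eng[OF that[unfolded G_def]] by (simp add: G_def)
  have G_T: "to_nat g \<in> G" if "g \<in> T" for g
    unfolding G_def using that by (intro generate.incl) simp
  have rep_T: "rep (key g) \<in> T" if "g \<in> level" for g
  proof -
    have "height (rep (key g)) = 0"
      using key_eqD(1)[OF rep] that by (simp add: level_def)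
    moreover have "key g \<in> K" using that by (simp add: K_def key_def level_def)
    ultimately show ?thesis by (simp add: T_def level_def)
  qed
  have G_diff: "to_nat (g - rep (key g)) \<in> G" if "(0, g) \<in> (slab 1 1 1)\<^sup>*" for g
    using that
  proof (induction rule: rtrancl_induct)
    case base
    have "inv\<^bsub>coxeter_group\<^esub> (to_nat (rep (key 0))) \<in> G"
      unfolding G_def using rep_T[OF level_zero] by (intro generate.inv) simp
    then show ?case by simp
  next
    case (step u v)
    then obtain s where s: "v = u + gen s" "height u \<in> {-1..1}" "height v \<in> {-1..1}"
      by (auto simp: slab_def)
    define r where "r = rep (key u) + gen s - rep (key v)"
    have v: "v - rep (key v) = (u - rep (key u)) + r"
      by (simp only: r_def s(1) diff_conv_add_uminus add.assoc minus_add_cancel)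
    have "r = - (u - rep (key u)) + (v - rep (key v))"
      unfolding v by (simp only: minus_add_cancel)
    then have "r \<in> level"
      using level_plus[OF level_uminus[OF diff_rep] diff_rep] by simp
    moreover have "r \<in> (\<lambda>(k, s, l). rep k + gen s - rep l) ` (K \<times> UNIV \<times> K)"
      by (rule image_eqI[of _ _ "(key u, s, key v)"])
        (use s(2,3) in \<open>simp_all add: r_def K_def key_def\<close>)
    ultimately have "r \<in> T" by (simp add: T_def)
    show ?case
      unfolding v by (rule G_plus[OF step.IH G_T[OF \<open>r \<in> T\<close>]])
  qed
  have "to_nat g \<in> G" if "g \<in> level" for g
    using G_plus[OF G_diff[OF level_connected[of g]] G_T[OF rep_T[OF that]]] that
    by (simp add: level_def)
  moreover have "G \<subseteq> to_nat ` level"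
    unfolding G_def
    by (rule group.generate_subgroup_incl[OF group_nat_group _ subgroup_level]) (auto simp: T_def)
  ultimately have "G = to_nat ` level" by blast
  moreover have "generate (coxeter_group\<lparr>carrier := to_nat ` level\<rparr>) (to_nat ` T) = G"
    unfolding G_def
    by (rule group.generate_consistent[OF group_nat_group _ subgroup_level]) (auto simp: T_def)
  moreover have "finite T" by (auto simp: T_def K_def)
  ultimately show ?thesis
    unfolding finitely_generated_def by (intro exI[of _ "to_nat ` T"]) (auto simp: T_def)
qed

section \<open>Infinitely many classes of involutions\<close>

text \<open>The point lies on the line since 4 * 4 = 1 modulo 5, so the two generators commute; both
  have direction 0, so the product fixes the grid.\<close>

definition rotation :: "vertex racg" where "rotation = gen (Pt 4 0) + gen (Ln 4 1)"

text \<open>The reflections in 1/2 and -1/2 compose to the translation by 2 of the first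
  coordinate.\<close>

definition shift :: "nat \<Rightarrow> vertex racg" where
  "shift n = (((+) (gen (Pt 0 0) + gen (Pt 2 0))) ^^ n) 0"

lemma pos_shift: "posA (shift n) = 2 * int n" "posB (shift n) = 0"
  by (induction n) (simp_all add: shift_def posA_plus posB_plus sg_def)

lemma adj_rotation: "adj (Pt 4 0) (Ln 4 1)"
  by simp

lemma pos_rotation: "posA rotation = 0" "posB rotation = 0"
  by (simp_all add: rotation_def posA_plus posB_plus)

lemma rotation_twice: "rotation + rotation = 0"
proof -
  have "rotation + rotation = gen (Pt 4 0) + gen (Ln 4 1) + (gen (Ln 4 1) + gen (Pt 4 0))"
    unfolding rotation_def gen_commute[OF adj_rotation] ..
  then show ?thesis by (simp add: add.assoc)
qed

lemma conj_rotation_level: "shift n + rotation - shift n \<in> level"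
  unfolding level_def using height_diff[of "shift n + rotation" "shift n"]
  by (simp add: height_def posA_plus posB_plus pos_rotation)

text \<open>The element \<open>c\<close> that takes \<open>shift n\<close> to
  \<open>h + shift m\<close> centralizes \<open>rotation\<close>, hence is one of four elements that
  do not move the origin. Comparing heights gives 2 n = 2 m or 2 n = - 2 m, and both force equality
  of natural numbers.\<close>

lemma shift_eq_of_conjugate:
  assumes h: "h \<in> level"
    and eq: "shift n + rotation - shift n = h + (shift m + rotation - shift m) - h"
  shows "n = m"
proof -
  define c where "c = - shift n + (h + shift m)"
  have hm: "h + shift m = shift n + c" by (simp add: c_def)
  have "shift n + rotation - shift n = (h + shift m) + rotation - (h + shift m)"
    unfolding eq by (simp only: diff_conv_add_uminus minus_add add.assoc)
  then have "shift n + (rotation - shift n) = shift n + (c + rotation - (shift n + c))"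
    unfolding hm by (simp only: diff_conv_add_uminus add.assoc)
  then have "rotation - shift n = c + rotation - (shift n + c)"
    by (simp only: add_left_cancel)
  then have "rotation - shift n + (shift n + c) = c + rotation"
    by (simp only: diff_add_cancel)
  then have comm: "c + rotation = rotation + c"
    by (simp only: diff_conv_add_uminus add.assoc minus_add_cancel)
  have "c \<in> {0, gen (Pt 4 0), gen (Ln 4 1), rotation}"
    unfolding rotation_def
    by (rule centralizer_rotation[OF _ adj_rotation comm[unfolded rotation_def]])
      (rule vertex_triangle_free)
  then have "posA c = 0 \<and> posB c = 0" using pos_rotation by auto
  then have "height (h + shift m) = 2 * int n"
    unfolding hm by (simp add: height_def posA_plus posB_plus pos_shift)
  moreover have "height (h + shift m) = sg (posA h) * (2 * int m)"
    using h height_plus_level[of h "shift m"] by (simp add: level_def height_def pos_shift)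
  ultimately show ?thesis using sg_cases[of "posA h"] by auto
qed

lemma infinite_classes_level:
  "infinite (finite_order_classes (coxeter_group\<lparr>carrier := to_nat ` level\<rparr>))"
proof -
  define H where "H = coxeter_group\<lparr>carrier := to_nat ` level\<rparr>"
  have carrier: "carrier H = to_nat ` level"
    and mult: "to_nat g \<otimes>\<^bsub>H\<^esub> to_nat h = to_nat (g + h)"
    and one: "\<one>\<^bsub>H\<^esub> = to_nat (0 :: vertex racg)" for g h :: "vertex racg"
    using mult_nat_group[of g h] by (simp_all add: H_def)
  have inv: "inv\<^bsub>H\<^esub> (to_nat g) = to_nat (- g)" if "g \<in> level" for g
    using group.m_inv_consistent[OF group_nat_group subgroup_level] that by (simp add: H_def)
  define x where "x n = shift n + rotation - shift n" for n
  have "x n + x n = shift n + (rotation + rotation) + - shift n" for n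
    by (simp only: x_def diff_conv_add_uminus add.assoc minus_add_cancel)
  then have "x n + x n = 0" for n by (simp add: rotation_twice)
  then have "to_nat (x n) [^]\<^bsub>H\<^esub> (2 :: nat) = \<one>\<^bsub>H\<^esub>" for n
    by (simp add: numeral_2_eq_2 nat_pow_def one mult)
  then have order: "finite_order H (to_nat (x n))" for n
    unfolding finite_order_def by (metis zero_less_numeral)
  have "to_nat (x n) \<in> carrier H" for n
    unfolding carrier x_def using conj_rotation_level by blast
  then have sub: "range (\<lambda>n. conjugacy_class H (to_nat (x n))) \<subseteq> finite_order_classes H"
    unfolding finite_order_classes_def using order by blast
  have class_iff: "y \<in> conjugacy_class H z \<longleftrightarrow>
      (\<exists>h\<in>level. y = to_nat h \<otimes>\<^bsub>H\<^esub> z \<otimes>\<^bsub>H\<^esub> inv\<^bsub>H\<^esub> (to_nat h))" for y z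
    by (auto simp: conjugacy_class_def carrier)
  have inj: "inj (\<lambda>n. conjugacy_class H (to_nat (x n)))"
  proof (rule injI)
    fix n m assume eq: "conjugacy_class H (to_nat (x n)) = conjugacy_class H (to_nat (x m))"
    have "to_nat (x n) \<in> conjugacy_class H (to_nat (x n))"
      unfolding class_iff by (rule bexI[OF _ level_zero]) (simp add: inv level_zero mult)
    then have "\<exists>h\<in>level. to_nat (x n) =
        to_nat h \<otimes>\<^bsub>H\<^esub> to_nat (x m) \<otimes>\<^bsub>H\<^esub> inv\<^bsub>H\<^esub> (to_nat h)"
      by (simp only: eq class_iff)
    then obtain h where h: "h \<in> level"
      "to_nat (x n) = to_nat h \<otimes>\<^bsub>H\<^esub> to_nat (x m) \<otimes>\<^bsub>H\<^esub> inv\<^bsub>H\<^esub> (to_nat h)" ..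
    then have "x n = h + x m - h" by (simp add: inv mult)
    then show "n = m"
      unfolding x_def by (rule shift_eq_of_conjugate[OF h(1)])
  qed
  show ?thesis
    using infinite_super[OF sub range_inj_infinite[OF inj]] unfolding H_def .
qed

theorem theorem2p1:
  shows "\<exists>(\<Gamma> :: nat monoid) H.
           hyperbolic_group \<Gamma> \<and>
           subgroup H \<Gamma> \<and>
           finitely_generated (\<Gamma>\<lparr>carrier := H\<rparr>) \<and>
           infinite (finite_order_classes (\<Gamma>\<lparr>carrier := H\<rparr>))"
proof (intro exI conjI)
  show "hyperbolic_group coxeter_group"
    by (rule hyperbolic_racg) (rule vertex_square_free)
qed (rule subgroup_level finitely_generated_level infinite_classes_level)+

end
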